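(* For $1\le t\le T$ set $$\widetilde w^*(t):=\frac{g_{\mathcal N}}{T}+w(t)-r(t)+\frac1T\sum_{s=1}^T[r(s)-w(s)],$$ let $\boldsymbol\pi^*=(\pi^*(1),\dots,\pi^*(T))^\top$ be the leader's strategy given by $$\pi^*(t):=1+\frac1n+\frac{\nu_{\mathcal N}(t)}{\widetilde w^*(t)},$$ and let $\boldsymbol\nu^*=(\boldsymbol\nu_1^*,\dots,\boldsymbol\nu_n^* )^\top$ with $\boldsymbol\nu_i^*=(\nu_i^*(1),\dots,\nu_i^*(T))^\top$ and $\nu_i^*(t):=\frac{g_i}{g_{\mathcal N}}\widetilde w^*(t)$. Suppose that $$0<\widetilde w^*(t)\le \min_{i\in\mathcal N}\left\{\frac{\nu_i^{\max}}{g_i}\right\}g_{\mathcal N}\qquad\text{for all }1\le t\le T.$$ Then: i) $\boldsymbol\nu^*$ is a strict Nash equilibrium, and the unique Nash equilibrium, of the follower game when the leader's strategy is $\boldsymbol\pi^*$; ii) $(\boldsymbol\pi^*,\boldsymbol\nu^* )$ is a perfect Stackelberg equilibrium of the Stackelberg game.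
   Context: Let $n,T$ be positive integers and $\mathcal N=\{1,\dots,n\}$ (followers, i.e. flexible electricity users). For each $i\in\mathcal N$ let $g_i>0$ (total demand) and $\nu_i^{\max}\ge g_i/T$ (maximal demand per time slot). Let $r(t),w(t)$, $t=1,\dots,T$, be given real sequences (demand of regular users, uncontrollable power generation). Put $g_{\mathcal N}=\sum_{i\in\mathcal N}g_i$. A strategy of follower $i$ is $\boldsymbol\nu_i=(\nu_i(1),\dots,\nu_i(T))^\top\in\mathbb R^T$; it is feasible if $\sum_{t=1}^T\nu_i(t)=g_i$ and $0\le\nu_i(t)\le\nu_i^{\max}$ for all $t$. Write $\boldsymbol\nu=(\boldsymbol\nu_1,\dots,\boldsymbol\nu_n)^\top$, $\boldsymbol\nu_{-i}$ for the strategies of all followers except $i$, and $\nu_{\mathcal N}(t)=\sum_{i\in\mathcal N}\nu_i(t)$. A leader's strategy is $\boldsymbol\pi=(\pi(1),\dots,\pi(T))^\top$, where $\pi(t)=\pi(\nu_{\mathcal N}(t),r(t),w(t))$ is a price that is a function of $\nu_{\mathcal N}(t),r(t),w(t)$. Follower game: given $\boldsymbol\pi$, each follower $i$ minimizes the cost $$u_i^f(\boldsymbol\pi,\boldsymbol\nu_i,\boldsymbol\nu_{-i})=\sum_{t=1}^T\pi(\nu_{\mathcal N}(t),r(t),w(t))\,\nu_i(t)$$ over its feasible strategies. A feasible combination $\boldsymbol\nu$ is a Nash equilibrium if $u_i^f(\boldsymbol\pi,\boldsymbol\nu_i',\boldsymbol\nu_{-i})\ge u_i^f(\boldsymbol\pi,\boldsymbol\nu_i,\boldsymbol\nu_{-i})$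 for every $i$ and every feasible $\boldsymbol\nu_i'$; it is strict if the inequality is strict whenever $\boldsymbol\nu_i'\ne\boldsymbol\nu_i$. Leader's cost: with $c(t)=\nu_{\mathcal N}(t)+r(t)-w(t)$ and $\bar c=\frac1T\sum_{t=1}^Tc(t)$, $$u^l(\boldsymbol\pi,\boldsymbol\nu)=\frac1T\sum_{t=1}^T[c(t)-\bar c]^2 .$$ Stackelberg equilibrium: $(\hat{\boldsymbol\pi},\hat{\boldsymbol\nu})$ is a Stackelberg equilibrium if $\hat{\boldsymbol\nu}$ is a Nash equilibrium of the follower game under $\hat{\boldsymbol\pi}$ and $u^l(\hat{\boldsymbol\pi},\hat{\boldsymbol\nu})\le u^l(\boldsymbol\pi,\boldsymbol\nu)$ for every leader's strategy $\boldsymbol\pi$ and every Nash equilibrium $\boldsymbol\nu$ of the follower game under $\boldsymbol\pi$. It is perfect if moreover $u^l(\hat{\boldsymbol\pi},\hat{\boldsymbol\nu})=0$. *)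

theory Defs
  imports "HOL-Analysis.Analysis"
begin

text \<open>
  The followers are the elements of the finite type \<open>'n\<close> and the time slots those of the
  finite type \<open>'t\<close>, so \<open>n = CARD('n)\<close> and \<open>T = CARD('t)\<close> are arbitrary positive
  integers. A strategy of one follower is a vector in \<open>real ^ 't\<close>, a strategy combination \<open>\<nu>\<close>
  is an element of \<open>real ^ 't ^ 'n\<close>, and \<open>\<nu> $ i $ t\<close> is the demand of follower \<open>i\<close> in slot \<open>t\<close>.
\<close>

definition aggregate :: "real ^ 't ^ 'n \<Rightarrow> 't \<Rightarrow> real" where
  "aggregate \<nu> t = (\<Sum>i\<in>UNIV. \<nu> $ i $ t)"

definition total_demand :: "real ^ 'n \<Rightarrow> real" where
  "total_demand g = (\<Sum>i\<in>UNIV. g $ i)"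

definition feasible :: "real ^ 'n \<Rightarrow> real ^ 'n \<Rightarrow> 'n \<Rightarrow> real ^ 't \<Rightarrow> bool" where
  "feasible g \<nu>max i x \<longleftrightarrow>
     (\<Sum>t\<in>UNIV. x $ t) = g $ i \<and> (\<forall>t. 0 \<le> x $ t \<and> x $ t \<le> \<nu>max $ i)"

definition feasible_combination :: "real ^ 'n \<Rightarrow> real ^ 'n \<Rightarrow> real ^ 't ^ 'n \<Rightarrow> bool" where
  "feasible_combination g \<nu>max \<nu> \<longleftrightarrow> (\<forall>i. feasible g \<nu>max i (\<nu> $ i))"

text \<open>The combination in which \<open>i\<close> plays \<open>x\<close> and all others play as in \<open>\<nu>\<close>.\<close>

definition deviate :: "real ^ 't ^ 'n \<Rightarrow> 'n \<Rightarrow> real ^ 't \<Rightarrow> real ^ 't ^ 'n" where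
  "deviate \<nu> i x = (\<chi> j. if j = i then x else \<nu> $ j)"

text \<open>
  A leader's strategy is a family of pricing rules: \<open>p t\<close> maps the aggregate flexible
  demand, the regular demand and the uncontrollable generation in slot \<open>t\<close> to the price in that
  slot. No condition is imposed on the rules, and they may differ from slot to slot.
\<close>

type_synonym 't leader_strategy = "'t \<Rightarrow> real \<Rightarrow> real \<Rightarrow> real \<Rightarrow> real"

definition price ::
    "real ^ 't \<Rightarrow> real ^ 't \<Rightarrow> 't leader_strategy \<Rightarrow> real ^ 't ^ 'n \<Rightarrow> 't \<Rightarrow> real" where
  "price r w p \<nu> t = p t (aggregate \<nu> t) (r $ t) (w $ t)"

definition follower_cost ::
    "real ^ 't \<Rightarrow> real ^ 't \<Rightarrow> 't leader_strategy \<Rightarrow> 'n \<Rightarrow> real ^ 't ^ 'n \<Rightarrow> real" where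
  "follower_cost r w p i \<nu> = (\<Sum>t\<in>UNIV. price r w p \<nu> t * \<nu> $ i $ t)"

definition nash_equilibrium ::
    "real ^ 'n \<Rightarrow> real ^ 'n \<Rightarrow> real ^ 't \<Rightarrow> real ^ 't \<Rightarrow> 't leader_strategy \<Rightarrow> real ^ 't ^ 'n \<Rightarrow> bool"
  where
  "nash_equilibrium g \<nu>max r w p \<nu> \<longleftrightarrow>
     feasible_combination g \<nu>max \<nu> \<and>
     (\<forall>i x. feasible g \<nu>max i x \<longrightarrow>
        follower_cost r w p i (deviate \<nu> i x) \<ge> follower_cost r w p i \<nu>)"

definition strict_nash_equilibrium ::
    "real ^ 'n \<Rightarrow> real ^ 'n \<Rightarrow> real ^ 't \<Rightarrow> real ^ 't \<Rightarrow> 't leader_strategy \<Rightarrow> real ^ 't ^ 'n \<Rightarrow> bool"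
  where
  "strict_nash_equilibrium g \<nu>max r w p \<nu> \<longleftrightarrow>
     nash_equilibrium g \<nu>max r w p \<nu> \<and>
     (\<forall>i x. feasible g \<nu>max i x \<and> x \<noteq> \<nu> $ i \<longrightarrow>
        follower_cost r w p i (deviate \<nu> i x) > follower_cost r w p i \<nu>)"

definition net_load :: "real ^ 't \<Rightarrow> real ^ 't \<Rightarrow> real ^ 't ^ 'n \<Rightarrow> 't \<Rightarrow> real" where
  "net_load r w \<nu> t = aggregate \<nu> t + r $ t - w $ t"

definition mean_net_load :: "real ^ 't \<Rightarrow> real ^ 't \<Rightarrow> real ^ 't ^ 'n \<Rightarrow> real" where
  "mean_net_load r w \<nu> = (1 / real CARD('t)) * (\<Sum>t\<in>UNIV. net_load r w \<nu> t)"

text \<open>The leader's cost depends on the leader's strategy only through the followers' response.\<close>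

definition leader_cost ::
    "real ^ 't \<Rightarrow> real ^ 't \<Rightarrow> 't leader_strategy \<Rightarrow> real ^ 't ^ 'n \<Rightarrow> real" where
  "leader_cost r w p \<nu> =
     (1 / real CARD('t)) * (\<Sum>t\<in>UNIV. (net_load r w \<nu> t - mean_net_load r w \<nu>)\<^sup>2)"

definition stackelberg_equilibrium ::
    "real ^ 'n \<Rightarrow> real ^ 'n \<Rightarrow> real ^ 't \<Rightarrow> real ^ 't \<Rightarrow> 't leader_strategy \<Rightarrow> real ^ 't ^ 'n \<Rightarrow> bool"
  where
  "stackelberg_equilibrium g \<nu>max r w p \<nu> \<longleftrightarrow>
     nash_equilibrium g \<nu>max r w p \<nu> \<and>
     (\<forall>p' \<nu>'. nash_equilibrium g \<nu>max r w p' \<nu>' \<longrightarrow>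
        leader_cost r w p \<nu> \<le> leader_cost r w p' \<nu>')"

definition perfect_stackelberg_equilibrium ::
    "real ^ 'n \<Rightarrow> real ^ 'n \<Rightarrow> real ^ 't \<Rightarrow> real ^ 't \<Rightarrow> 't leader_strategy \<Rightarrow> real ^ 't ^ 'n \<Rightarrow> bool"
  where
  "perfect_stackelberg_equilibrium g \<nu>max r w p \<nu> \<longleftrightarrow>
     stackelberg_equilibrium g \<nu>max r w p \<nu> \<and> leader_cost r w p \<nu> = 0"

text \<open>
  The expression defining \<open>w_tilde\<close> as a function of the values \<open>\<rho>\<close>, \<open>\<omega>\<close> of \<open>r\<close> and \<open>w\<close> in the
  current slot, the remaining terms being constants of the game. It is separated out so that
  \<open>pi_star\<close> is visibly one function of aggregate demand, \<open>\<rho>\<close> and \<open>\<omega>\<close>, the same in every slot.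
\<close>

definition w_tilde_at ::
    "real ^ 'n \<Rightarrow> real ^ 't \<Rightarrow> real ^ 't \<Rightarrow> real \<Rightarrow> real \<Rightarrow> real" where
  "w_tilde_at g r w \<rho> \<omega> =
     total_demand g / real CARD('t) + \<omega> - \<rho>
     + (1 / real CARD('t)) * (\<Sum>s\<in>UNIV. r $ s - w $ s)"

definition w_tilde :: "real ^ 'n \<Rightarrow> real ^ 't \<Rightarrow> real ^ 't \<Rightarrow> 't \<Rightarrow> real" where
  "w_tilde g r w t = w_tilde_at g r w (r $ t) (w $ t)"

definition pi_star :: "real ^ 'n \<Rightarrow> real ^ 't \<Rightarrow> real ^ 't \<Rightarrow> 't leader_strategy" where
  "pi_star g r w = (\<lambda>t x \<rho> \<omega>. 1 + 1 / real CARD('n) + x / w_tilde_at g r w \<rho> \<omega>)"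

definition nu_star :: "real ^ 'n \<Rightarrow> real ^ 't \<Rightarrow> real ^ 't \<Rightarrow> real ^ 't ^ 'n" where
  "nu_star g r w = (\<chi> i t. g $ i / total_demand g * w_tilde g r w t)"

lemma price_pi_star:
  fixes g :: "real ^ 'n" and \<nu> :: "real ^ 't ^ 'n"
  shows "price r w (pi_star g r w) \<nu> t =
    1 + 1 / real CARD('n) + aggregate \<nu> t / w_tilde g r w t"
  by (simp add: price_def pi_star_def w_tilde_def)

end

theory Submission
  imports Defs
begin

text \<open>
  Write \<open>W\<close> for \<open>w_tilde g r w\<close> and \<open>G\<close> for \<open>total_demand g\<close>. Under \<open>pi_star\<close> the price
  is affine in the aggregate demand, so a follower's cost is a quadratic function of its own
  strategy. At \<open>nu_star\<close> the aggregate demand is \<open>W\<close> and follower \<open>i\<close> uses the fraction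
  \<open>g $ i / G\<close> of it, so the marginal cost of \<open>i\<close> is the same in all slots. Moving demand
  between slots then has no first-order effect, and only the term \<open>d t ^ 2 / W t\<close> of second
  order remains; it is positive, which is why \<open>nu_star\<close> is a strict equilibrium. The upper
  bound on \<open>W\<close> says exactly that \<open>nu_star\<close> respects the slot limits \<open>\<nu>max\<close>.

  More generally, \<open>follower_cost_change\<close> expresses the cost change caused by a deviation
  \<open>d\<close> from an arbitrary combination \<open>\<nu>\<close> in terms of the displacement
  \<open>\<delta> j t = \<nu> $ j $ t - nu_star g r w $ j $ t\<close> and its total \<open>D t\<close> over the followers.
  If \<open>\<nu>\<close> is an equilibrium, no follower gains by moving halfway to its strategy in
  \<open>nu_star\<close>, that is, by \<open>d = - \<delta> i / 2\<close>. The gains excluded in this way add up over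
  the followers to the sum over the slots of \<open>(D t ^ 2 / 2 + (\<Sum>j. \<delta> j t ^ 2) / 4) / W t\<close>,
  so all displacements vanish and the equilibrium is unique.

  For the leader, the aggregate \<open>W\<close> makes the net load constant in time, so the
  variance that the leader minimizes takes its least possible value \<open>0\<close>.
\<close>

lemma sum_w_tilde:
  fixes g :: "real ^ 'n" and r w :: "real ^ 't"
  shows "(\<Sum>t\<in>UNIV. w_tilde g r w t) = total_demand g"
  by (simp add: w_tilde_def w_tilde_at_def sum.distrib sum_subtractf)

lemma aggregate_nu_star:
  fixes g :: "real ^ 'n" and r w :: "real ^ 't"
  assumes "total_demand g \<noteq> 0"
  shows "aggregate (nu_star g r w) t = w_tilde g r w t"
proof -
  have "aggregate (nu_star g r w) t = total_demand g / total_demand g * w_tilde g r w t"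
    unfolding aggregate_def nu_star_def total_demand_def
    by (simp flip: sum_distrib_right sum_divide_distrib)
  then show ?thesis
    using assms by simp
qed

lemma aggregate_deviate:
  fixes \<nu> :: "real ^ 't ^ 'n"
  shows "aggregate (deviate \<nu> i x) t = aggregate \<nu> t + (x $ t - \<nu> $ i $ t)"
proof -
  have "deviate \<nu> i x $ j $ t = \<nu> $ j $ t + (if j = i then x $ t - \<nu> $ i $ t else 0)" for j
    by (simp add: deviate_def)
  then show ?thesis
    by (simp add: aggregate_def sum.distrib)
qed

lemma feasible_midpoint:
  assumes "feasible g \<nu>max i x" and "feasible g \<nu>max i y"
  shows "feasible g \<nu>max i (\<chi> t. (x $ t + y $ t) / 2)"
proof -
  have "(\<Sum>t\<in>UNIV. (x $ t + y $ t) / 2) = g $ i"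
    using assms by (simp add: feasible_def sum.distrib flip: sum_divide_distrib)
  moreover have "0 \<le> (x $ t + y $ t) / 2 \<and> (x $ t + y $ t) / 2 \<le> \<nu>max $ i" for t
    using assms[unfolded feasible_def, THEN conjunct2, rule_format, of t] by simp
  ultimately show ?thesis
    by (simp add: feasible_def)
qed

lemma sum_divide_eq_0D:
  fixes f W :: "'t::finite \<Rightarrow> real"
  assumes "(\<Sum>t\<in>UNIV. f t / W t) \<le> 0" and "\<And>t. f t \<ge> 0" and "\<And>t. W t > 0"
  shows "f t = 0"
proof -
  have nonneg: "f s / W s \<ge> 0" for s
    using assms(2)[of s] assms(3)[of s] by simp
  then have "(\<Sum>t\<in>UNIV. f t / W t) = 0"
    using assms(1) by (meson order_antisym sum_nonneg)
  then have "f t / W t = 0"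
    using nonneg by (simp add: sum_nonneg_eq_0_iff)
  then show ?thesis
    using assms(3)[of t] by simp
qed

text \<open>
  The two differences on the right measure how far \<open>\<nu>\<close> is from \<open>nu_star\<close>: the marginal cost
  of follower \<open>i\<close> under \<open>pi_star\<close> exceeds its constant value at \<open>nu_star\<close> by the sum of
  these two differences divided by \<open>w_tilde\<close>. The constant drops out since a deviation only
  shifts demand between slots.
\<close>

lemma follower_cost_change:
  fixes g :: "real ^ 'n" and r w x :: "real ^ 't" and \<nu> :: "real ^ 't ^ 'n"
  assumes W: "\<And>t. w_tilde g r w t > 0"
    and same_total: "(\<Sum>t\<in>UNIV. x $ t) = (\<Sum>t\<in>UNIV. \<nu> $ i $ t)"
  shows "follower_cost r w (pi_star g r w) i (deviate \<nu> i x)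
         - follower_cost r w (pi_star g r w) i \<nu>
       = (\<Sum>t\<in>UNIV. ((x $ t - \<nu> $ i $ t)\<^sup>2 + (x $ t - \<nu> $ i $ t) *
            ((aggregate \<nu> t - w_tilde g r w t) + (\<nu> $ i $ t - nu_star g r w $ i $ t)))
          / w_tilde g r w t)"
    (is "?change = (\<Sum>t\<in>UNIV. ?q t)")
proof -
  \<comment> \<open>The marginal cost of \<open>i\<close> at \<open>nu_star\<close>, the same in every slot.\<close>
  define c where "c = 2 + 1 / real CARD('n) + g $ i / total_demand g"
  have slot: "(1 + k + (a + (y - z)) / v) * y - (1 + k + a / v) * z
      = ((y - z)\<^sup>2 + (y - z) * ((a - v) + (z - m * v))) / v + (2 + k + m) * (y - z)"
    if "v > 0" for a y z v k m :: real
    using that by (simp add: field_simps power2_eq_square)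
  have "?change = (\<Sum>t\<in>UNIV. ?q t + c * (x $ t - \<nu> $ i $ t))"
    unfolding follower_cost_def price_pi_star aggregate_deviate sum_subtractf[symmetric]
    using slot[OF W, where k = "1 / real CARD('n)" and m = "g $ i / total_demand g"] by (intro sum.cong refl) (simp add: c_def deviate_def nu_star_def)
  also have "\<dots> = (\<Sum>t\<in>UNIV. ?q t)"
    using same_total by (simp add: sum.distrib sum_subtractf flip: sum_distrib_left)
  finally show ?thesis .
qed

lemma feasible_nu_star:
  fixes g \<nu>max :: "real ^ 'n" and r w :: "real ^ 't"
  assumes g: "\<And>i. g $ i > 0"
    and W: "\<And>t. 0 < w_tilde g r w t"
    and bound: "\<And>t. w_tilde g r w t \<le> (MIN i\<in>UNIV. \<nu>max $ i / g $ i) * total_demand g"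
  shows "feasible g \<nu>max i (nu_star g r w $ i)"
proof -
  have G: "total_demand g > 0"
    unfolding total_demand_def using g by (simp add: sum_pos)
  have "g $ i / total_demand g * w_tilde g r w t \<le> \<nu>max $ i" for t
  proof -
    have "(MIN j\<in>UNIV. \<nu>max $ j / g $ j) \<le> \<nu>max $ i / g $ i"
      by (intro Min_le) auto
    then have "w_tilde g r w t \<le> \<nu>max $ i / g $ i * total_demand g"
      using bound[of t] G by (meson less_imp_le mult_right_mono order_trans)
    then show ?thesis
      using G g[of i] by (simp add: field_simps)
  qed
  moreover have "(\<Sum>t\<in>UNIV. g $ i / total_demand g * w_tilde g r w t) = g $ i"
    using G unfolding sum_distrib_left[symmetric] sum_w_tilde by simp
  moreover have "0 \<le> g $ i / total_demand g * w_tilde g r w t" for t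
    using G g[of i] W[of t] by simp
  ultimately show ?thesis
    by (simp add: feasible_def nu_star_def)
qed

text \<open>
  Every displacement from \<open>nu_star\<close> vanishes at \<open>nu_star\<close> itself, so only the
  quadratic part of the cost change survives there.
\<close>

lemma strict_nash_nu_star:
  fixes g \<nu>max :: "real ^ 'n" and r w :: "real ^ 't"
  assumes W: "\<And>t. 0 < w_tilde g r w t"
    and G: "total_demand g \<noteq> 0"
    and feas: "\<And>i. feasible g \<nu>max i (nu_star g r w $ i)"
  shows "strict_nash_equilibrium g \<nu>max r w (pi_star g r w) (nu_star g r w)"
proof -
  let ?\<nu> = "nu_star g r w"
  let ?cost = "follower_cost r w (pi_star g r w)"
  have change: "?cost i (deviate ?\<nu> i x) - ?cost i ?\<nu>
      = (\<Sum>t\<in>UNIV. (x $ t - ?\<nu> $ i $ t)\<^sup>2 / w_tilde g r w t)"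
    if "feasible g \<nu>max i x" for i x
    using that feas[of i] G
    by (subst follower_cost_change[OF W]) (simp_all add: feasible_def aggregate_nu_star)
  have strict: "?cost i (deviate ?\<nu> i x) > ?cost i ?\<nu>"
    if x: "feasible g \<nu>max i x" and ne: "x \<noteq> ?\<nu> $ i" for i x
  proof (rule ccontr)
    assume "\<not> ?thesis"
    then have "(\<Sum>t\<in>UNIV. (x $ t - ?\<nu> $ i $ t)\<^sup>2 / w_tilde g r w t) \<le> 0"
      using change[OF x] by simp
    then have "(x $ t - ?\<nu> $ i $ t)\<^sup>2 = 0" for t
      by (rule sum_divide_eq_0D) (simp_all add: W)
    then show False
      using ne by (simp add: vec_eq_iff)
  qed
  have "deviate ?\<nu> i (?\<nu> $ i) = ?\<nu>" for i
    by (simp add: deviate_def vec_eq_iff)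
  then have "?cost i (deviate ?\<nu> i x) \<ge> ?cost i ?\<nu>" if "feasible g \<nu>max i x" for i x
    using strict[OF that] by (cases "x = ?\<nu> $ i") auto
  then show ?thesis
    using strict feas
    by (simp add: strict_nash_equilibrium_def nash_equilibrium_def feasible_combination_def)
qed

text \<open>
  Moving all the way to \<open>nu_star\<close> would only yield \<open>D = 0\<close>, since the quadratic part of
  the cost change then cancels the terms \<open>\<delta> i t ^ 2\<close>. With half a step the quadratic part
  cancels only half of them, and the summed inequality controls each follower's displacement.
\<close>

lemma nash_equilibrium_unique:
  fixes g \<nu>max :: "real ^ 'n" and r w :: "real ^ 't"
  assumes W: "\<And>t. 0 < w_tilde g r w t"
    and G: "total_demand g \<noteq> 0"
    and feas: "\<And>i. feasible g \<nu>max i (nu_star g r w $ i)"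
    and nash: "nash_equilibrium g \<nu>max r w (pi_star g r w) \<nu>"
  shows "\<nu> = nu_star g r w"
proof -
  define \<delta> where "\<delta> i t = \<nu> $ i $ t - nu_star g r w $ i $ t" for i t
  define D where "D t = aggregate \<nu> t - w_tilde g r w t" for t
  have D_sum: "D t = (\<Sum>i\<in>UNIV. \<delta> i t)" for t
    unfolding D_def \<delta>_def aggregate_nu_star[OF G, symmetric] aggregate_def
    by (simp add: sum_subtractf)
  have feas\<nu>: "feasible g \<nu>max i (\<nu> $ i)" for i
    using nash by (simp add: nash_equilibrium_def feasible_combination_def)
  have halfway: "(\<Sum>t\<in>UNIV. (D t * \<delta> i t / 2 + (\<delta> i t)\<^sup>2 / 4) / w_tilde g r w t) \<le> 0" for i
  proof -
    define x where "x = (\<chi> t. (\<nu> $ i $ t + nu_star g r w $ i $ t) / 2)"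
    have x: "feasible g \<nu>max i x"
      unfolding x_def by (rule feasible_midpoint[OF feas\<nu> feas])
    have step: "x $ t - \<nu> $ i $ t = - \<delta> i t / 2" for t
      by (simp add: x_def \<delta>_def field_simps)
    have "0 \<le> follower_cost r w (pi_star g r w) i (deviate \<nu> i x)
        - follower_cost r w (pi_star g r w) i \<nu>"
      using nash x by (simp add: nash_equilibrium_def)
    also have "\<dots> = (\<Sum>t\<in>UNIV. ((- \<delta> i t / 2)\<^sup>2 + (- \<delta> i t / 2) * (D t + \<delta> i t))
        / w_tilde g r w t)"
      using x feas\<nu>[of i]
      by (subst follower_cost_change[OF W]) (simp_all add: feasible_def step flip: D_def \<delta>_def)
    also have "\<dots> = (\<Sum>t\<in>UNIV. - ((D t * \<delta> i t / 2 + (\<delta> i t)\<^sup>2 / 4) / w_tilde g r w t))"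
      by (intro sum.cong refl, subst minus_divide_left, rule arg_cong2[where f = "(/)"])
        (simp_all add: power2_eq_square algebra_simps)
    finally show ?thesis
      by (simp add: sum_negf)
  qed
  have "(\<Sum>t\<in>UNIV. ((D t)\<^sup>2 / 2 + (\<Sum>i\<in>UNIV. (\<delta> i t)\<^sup>2) / 4) / w_tilde g r w t)
      = (\<Sum>t\<in>UNIV. \<Sum>i\<in>UNIV. (D t * \<delta> i t / 2 + (\<delta> i t)\<^sup>2 / 4) / w_tilde g r w t)"
  proof (intro sum.cong refl)
    fix t
    have "(\<Sum>i\<in>UNIV. D t * \<delta> i t / 2 + (\<delta> i t)\<^sup>2 / 4)
        = (D t)\<^sup>2 / 2 + (\<Sum>i\<in>UNIV. (\<delta> i t)\<^sup>2) / 4"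
      by (simp add: D_sum[of t] power2_eq_square[of "sum _ _"] sum.distrib
          flip: sum_divide_distrib sum_distrib_left)
    then show "((D t)\<^sup>2 / 2 + (\<Sum>i\<in>UNIV. (\<delta> i t)\<^sup>2) / 4) / w_tilde g r w t
        = (\<Sum>i\<in>UNIV. (D t * \<delta> i t / 2 + (\<delta> i t)\<^sup>2 / 4) / w_tilde g r w t)"
      by (simp flip: sum_divide_distrib)
  qed
  also have "\<dots> = (\<Sum>i\<in>UNIV. \<Sum>t\<in>UNIV. (D t * \<delta> i t / 2 + (\<delta> i t)\<^sup>2 / 4) / w_tilde g r w t)"
    by (rule sum.swap)
  also have "\<dots> \<le> 0"
    by (intro sum_nonpos halfway)
  finally have "(D t)\<^sup>2 / 2 + (\<Sum>i\<in>UNIV. (\<delta> i t)\<^sup>2) / 4 = 0" for t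
    by (rule sum_divide_eq_0D) (simp_all add: W sum_nonneg)
  then have "(\<Sum>i\<in>UNIV. (\<delta> i t)\<^sup>2) = 0" for t
    by (subst (asm) add_nonneg_eq_0_iff) (simp_all add: sum_nonneg)
  then have "\<delta> i t = 0" for i t
    by (simp add: sum_nonneg_eq_0_iff)
  then show ?thesis
    by (simp add: vec_eq_iff \<delta>_def)
qed

lemma leader_cost_nonneg: "0 \<le> leader_cost r w p \<nu>"
  by (simp add: leader_cost_def sum_nonneg)

lemma leader_cost_nu_star:
  fixes g :: "real ^ 'n" and r w :: "real ^ 't"
  assumes "total_demand g \<noteq> 0"
  shows "leader_cost r w p (nu_star g r w) = 0"
proof -
  define c where
    "c = total_demand g / real CARD('t) + (1 / real CARD('t)) * (\<Sum>s\<in>UNIV. r $ s - w $ s)"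
  have load: "net_load r w (nu_star g r w) t = c" for t
    using assms by (simp add: net_load_def aggregate_nu_star w_tilde_def w_tilde_at_def c_def)
  then have "mean_net_load r w (nu_star g r w) = c"
    by (simp add: mean_net_load_def)
  with load show ?thesis
    by (simp add: leader_cost_def)
qed

theorem theorem3p1:
  fixes g \<nu>max :: "real ^ 'n" and r w :: "real ^ 't"
  assumes "\<And>i. g $ i > 0"
    and "\<And>i. \<nu>max $ i \<ge> g $ i / real CARD('t)"
    and "\<And>t. 0 < w_tilde g r w t"
    and "\<And>t. w_tilde g r w t \<le> (MIN i\<in>UNIV. \<nu>max $ i / g $ i) * total_demand g"
  shows "strict_nash_equilibrium g \<nu>max r w (pi_star g r w) (nu_star g r w) \<and>
     (\<forall>\<nu>. nash_equilibrium g \<nu>max r w (pi_star g r w) \<nu> \<longrightarrow> \<nu> = nu_star g r w) \<and>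
     perfect_stackelberg_equilibrium g \<nu>max r w (pi_star g r w) (nu_star g r w)"
proof -
  have "total_demand g > 0"
    unfolding total_demand_def using assms(1) by (simp add: sum_pos)
  then have G: "total_demand g \<noteq> 0"
    by simp
  note feas = feasible_nu_star[OF assms(1,3,4)]
  have strict: "strict_nash_equilibrium g \<nu>max r w (pi_star g r w) (nu_star g r w)"
    using strict_nash_nu_star[OF assms(3) G feas] .
  moreover have "perfect_stackelberg_equilibrium g \<nu>max r w (pi_star g r w) (nu_star g r w)"
    using strict
    by (simp add: perfect_stackelberg_equilibrium_def stackelberg_equilibrium_def
        strict_nash_equilibrium_def leader_cost_nu_star[OF G] leader_cost_nonneg)
  ultimately show ?thesis
    using nash_equilibrium_unique[OF assms(3) G feas] by blast
qed

end
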